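(* Let $\delta$ be an algebraic integer of degree $d$ and let $E$ be a finite alphabet of Pisot numbers of degree $d$ all belonging to $\mathbb{Z}[\delta]$. Then for every $r\in\mathbb{Q}(\delta)\cap[0,1]$, the transducers $\mathcal{T}_{E,r}$ and $\mathcal{T}^*_{E,r}$ are finite (have finitely many states).
   Context: A Pisot number is a real algebraic integer $>1$ all of whose other Galois conjugates have modulus $<1$. For $\beta>1$ let $\mathsf{T}_\beta\colon[0,1]\to[0,1)$, $r\mapsto\beta r-\lfloor\beta r\rfloor$, and $\mathsf{T}^*_\beta(r)=\beta r-\lceil\beta r-1\rceil$ for $r\in(0,1]$, $\mathsf{T}^*_\beta(0)=0$. For a finite $E\subset\mathbb{R}_{>1}$, the infinite letter-to-letter transducer $\mathcal{T}_E$ has state set $[0,1]$, input alphabet $E$, output alphabet $\mathbb{N}$, and for each state $r$ and each $\beta\in E$ a transition $r\xrightarrow{\beta\,|\,\lfloor\beta r\rfloor}\mathsf{T}_\beta(r)$; $\mathcal{T}^*_E$ is the same with transitions $r\xrightarrow{\beta\,|\,\lceil\beta r-1\rceil}\mathsf{T}^*_\beta(r)$. For $r\in[0,1]$, $\mathcal{T}_{E,r}$ (resp. $\mathcal{T}^*_{E,r}$) is the part of $\mathcal{T}_E$ (resp. $\mathcal{T}^*_E$) reachable from the state $r$. Reading a Cantor real base $\mathbf{B}\in E^{\mathbb{N}}$ from state $r$ in $\mathcal{T}_E$ (resp. $\mathcal{T}^*_E$) outputs the greedy (resp. quasi-greedy) $\mathbf{B}$-expansion of $r$. *)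

theory Defs
  imports Complex_Main "HOL-Computational_Algebra.Computational_Algebra"
begin

definition is_min_poly :: "rat poly \<Rightarrow> 'a :: field_char_0 \<Rightarrow> bool" where
  "is_min_poly p x \<longleftrightarrow>
     lead_coeff p = 1 \<and> irreducible p \<and> poly (map_poly of_rat p) x = 0"

text \<open>Only meaningful for algebraic \<open>x\<close>; see \<open>is_min_poly_min_poly\<close> below.\<close>

definition min_poly :: "'a :: field_char_0 \<Rightarrow> rat poly" where
  "min_poly x = (THE p. is_min_poly p x)"

definition alg_degree :: "'a :: field_char_0 \<Rightarrow> nat" where
  "alg_degree x = degree (min_poly x)"

definition galois_conjugates :: "'a :: field_char_0 \<Rightarrow> complex set" where
  "galois_conjugates x = {z. poly (map_poly of_rat (min_poly x)) z = 0}"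

definition Pisot :: "real \<Rightarrow> bool" where
  "Pisot \<beta> \<longleftrightarrow> algebraic_int \<beta> \<and> \<beta> > 1 \<and>
     (\<forall>z \<in> galois_conjugates \<beta> - {complex_of_real \<beta>}. cmod z < 1)"

definition int_adjoin :: "complex \<Rightarrow> complex set" where
  "int_adjoin \<delta> = {poly (map_poly of_int p) \<delta> | p :: int poly. True}"

definition rat_adjoin :: "complex \<Rightarrow> complex set" where
  "rat_adjoin \<delta> = {poly (map_poly of_rat p) \<delta> / poly (map_poly of_rat q) \<delta> | p q :: rat poly.
                     poly (map_poly of_rat q) \<delta> \<noteq> 0}"

record ('s, 'i, 'o) transducer =
  states :: "'s set"
  input_alphabet :: "'i set"
  transitions :: "('s \<times> 'i \<times> 'o \<times> 's) set"

definition steps :: "('s, 'i, 'o) transducer \<Rightarrow> ('s \<times> 's) set" where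
  "steps M = {(s, t). \<exists>a b. (s, a, b, t) \<in> transitions M}"

definition reachable_part :: "('s, 'i, 'o) transducer \<Rightarrow> 's \<Rightarrow> ('s, 'i, 'o) transducer" where
  "reachable_part M r =
     \<lparr> states = {s \<in> states M. (r, s) \<in> (steps M)\<^sup>*},
       input_alphabet = input_alphabet M,
       transitions = {(s, a, b, t) \<in> transitions M. (r, s) \<in> (steps M)\<^sup>*} \<rparr>"

definition T_greedy :: "real \<Rightarrow> real \<Rightarrow> real" where
  "T_greedy \<beta> r = \<beta> * r - of_int \<lfloor>\<beta> * r\<rfloor>"

definition T_quasi :: "real \<Rightarrow> real \<Rightarrow> real" where
  "T_quasi \<beta> r = (if r = 0 then 0 else \<beta> * r - of_int \<lceil>\<beta> * r - 1\<rceil>)"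

definition greedy_transducer :: "real set \<Rightarrow> (real, real, nat) transducer" where
  "greedy_transducer E =
     \<lparr> states = {0..1}, input_alphabet = E,
       transitions = {(r, \<beta>, nat \<lfloor>\<beta> * r\<rfloor>, T_greedy \<beta> r) | r \<beta>. r \<in> {0..1} \<and> \<beta> \<in> E} \<rparr>"

text \<open>At the state \<open>0\<close> the output \<open>\<lceil>\<beta> r - 1\<rceil>\<close> would be \<open>-1\<close>; the truncation by \<open>nat\<close> turns
  it into the digit \<open>0\<close>, as demanded by the output alphabet and by \<open>T_quasi \<beta> 0 = 0\<close>.
  At all other states the output is nonnegative and \<open>nat\<close> does not change it.\<close>

definition quasi_greedy_transducer :: "real set \<Rightarrow> (real, real, nat) transducer" where
  "quasi_greedy_transducer E =
     \<lparr> states = {0..1}, input_alphabet = E,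
       transitions = {(r, \<beta>, nat \<lceil>\<beta> * r - 1\<rceil>, T_quasi \<beta> r) | r \<beta>. r \<in> {0..1} \<and> \<beta> \<in> E} \<rparr>"

lemma T_greedy_range: "T_greedy \<beta> r \<in> {0..<1}"
  unfolding T_greedy_def by (auto, linarith+)

lemma T_quasi_range: "T_quasi \<beta> r \<in> {0..1}"
proof -
  have "of_int \<lceil>\<beta> * r - 1\<rceil> \<le> \<beta> * r" "\<beta> * r \<le> of_int \<lceil>\<beta> * r - 1\<rceil> + 1"
    by linarith+
  thus ?thesis unfolding T_quasi_def by simp
qed

lemma map_poly_of_rat_add:
  "map_poly of_rat (p + q) = (map_poly of_rat p + map_poly of_rat q :: 'a :: field_char_0 poly)"
  by (rule poly_eqI) (simp add: coeff_map_poly of_rat_add)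

lemma map_poly_of_rat_mult:
  "map_poly of_rat (p * q) = (map_poly of_rat p * map_poly of_rat q :: 'a :: field_char_0 poly)"
  by (rule poly_eqI) (simp add: coeff_map_poly coeff_mult of_rat_sum of_rat_mult)

lemma ex1_min_poly:
  fixes x :: "'a :: field_char_0"
  assumes "algebraic x"
  shows "\<exists>!p. is_min_poly p x"
proof -
  let ?R = "\<lambda>p. poly (map_poly of_rat p) x"
  have mult: "?R (p * q) = ?R p * ?R q" for p q
    by (simp add: map_poly_of_rat_mult)
  have add: "?R (p + q) = ?R p + ?R q" for p q
    by (simp add: map_poly_of_rat_add)
  have "\<exists>p. p \<noteq> 0 \<and> ?R p = 0"
  proof -
    obtain p where p: "\<forall>i. coeff p i \<in> \<rat>" "p \<noteq> 0" "poly p x = 0"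
      using assms unfolding algebraic_altdef by blast
    obtain q where "p = map_poly of_rat q" using p(1) ratpolyE by metis
    with p show ?thesis by (intro exI[of _ q]) auto
  qed
  then obtain m0 where m0: "m0 \<noteq> 0" "?R m0 = 0"
    and least: "\<And>q. q \<noteq> 0 \<Longrightarrow> ?R q = 0 \<Longrightarrow> degree m0 \<le> degree q"
    using ex_has_least_nat[of "\<lambda>p. p \<noteq> 0 \<and> ?R p = 0" _ degree] by blast
  define m where "m = smult (inverse (lead_coeff m0)) m0"
  have m: "lead_coeff m = 1" "m \<noteq> 0" "degree m = degree m0"
    using m0 by (auto simp: m_def)
  have Rm: "?R m = 0"
    using m0 mult[of "[:inverse (lead_coeff m0):]" m0] by (simp add: m_def)
  have dvd: "m dvd q" if "?R q = 0" for q
  proof -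
    have "?R (q mod m) = 0"
      using add[of "m * (q div m)" "q mod m"] mult[of m "q div m"] Rm that by simp
    hence "q mod m = 0"
      using least[of "q mod m"] degree_mod_less[of m q] m by fastforce
    thus ?thesis by auto
  qed
  have deg: "degree m \<noteq> 0"
  proof
    assume "degree m = 0"
    then obtain c where c: "m = [:c:]" by (auto elim: degree_eq_zeroE)
    with m have "c = 1" by auto
    with c Rm show False by (simp add: map_poly_pCons)
  qed
  have irr: "irreducible m"
  proof (rule irreducibleI)
    show "\<not> m dvd 1" using deg m(2) by (auto simp: is_unit_iff_degree)
    fix a b assume ab: "m = a * b"
    hence nz: "a \<noteq> 0" "b \<noteq> 0" using m by auto
    have "?R a = 0 \<or> ?R b = 0" using Rm ab mult[of a b] by auto
    hence "degree m \<le> degree a \<or> degree m \<le> degree b" using least nz m by auto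
    hence "degree a = 0 \<or> degree b = 0" using ab nz by (auto simp: degree_mult_eq)
    thus "a dvd 1 \<or> b dvd 1" using nz by (auto simp: is_unit_iff_degree)
  qed (use m in auto)
  have "is_min_poly m x" using m irr Rm by (simp add: is_min_poly_def)
  moreover have "p = m" if p: "is_min_poly p x" for p
  proof -
    obtain k where k: "p = m * k" using dvd[of p] p by (auto simp: is_min_poly_def elim: dvdE)
    have "\<not> m dvd 1" using irr by (auto simp: irreducible_def)
    hence "k dvd 1" using p k irreducibleD[of p m k] by (auto simp: is_min_poly_def)
    moreover have "k \<noteq> 0" using p k by (auto simp: is_min_poly_def)
    ultimately have "degree k = 0" by (simp add: is_unit_iff_degree)
    then obtain c where c: "k = [:c:]" by (auto elim: degree_eq_zeroE)
    have "lead_coeff k = 1" using p k m by (simp add: is_min_poly_def lead_coeff_mult)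
    with c k show ?thesis by (simp add: one_pCons[symmetric])
  qed
  ultimately show ?thesis by blast
qed

lemma is_min_poly_min_poly: "algebraic x \<Longrightarrow> is_min_poly (min_poly x) x"
  unfolding min_poly_def by (rule theI') (rule ex1_min_poly)

end

theory Submission
  imports Defs "HOL-Computational_Algebra.Field_as_Ring"
begin

text \<open>
  Write \<open>r = P\<^sub>0(\<delta>) / q(\<delta>)\<close> with integer polynomials. Since every \<open>\<beta> \<in> E\<close> is \<open>B(\<delta>)\<close> for an integer
  polynomial \<open>B\<close>, every reachable state \<open>s\<close> satisfies \<open>q(\<delta>) s = P(\<delta>)\<close>, where a transition
  \<open>s \<mapsto> \<beta> s - k\<close> replaces \<open>P\<close> by \<open>B P - k q\<close>. As \<open>\<beta>\<close> has the same degree as \<open>\<delta>\<close>, it generates the same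
  field, so \<open>B\<close> maps every conjugate \<open>z \<noteq> \<delta>\<close> of \<open>\<delta>\<close> to a conjugate of \<open>\<beta>\<close> other than \<open>\<beta>\<close> itself, and
  \<open>|B(z)| < 1\<close> by the Pisot property. Hence the transitions contract the values \<open>P(z)\<close> up to a bounded
  error, while \<open>|P(\<delta>)| \<le> |q(\<delta>)|\<close> because \<open>s \<in> [0, 1]\<close>. So all conjugates of \<open>P(\<delta>)\<close> are
  bounded, and only finitely many elements of \<open>\<int>[\<delta>]\<close> have bounded conjugates.
\<close>

section \<open>Evaluating rational and integer polynomials\<close>

abbreviation rpoly :: "rat poly \<Rightarrow> 'a :: field_char_0 \<Rightarrow> 'a" where
  "rpoly p x \<equiv> poly (map_poly of_rat p) x"

abbreviation ipoly :: "int poly \<Rightarrow> 'a :: field_char_0 \<Rightarrow> 'a" where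
  "ipoly p x \<equiv> poly (map_poly of_int p) x"

lemma rpoly_add: "rpoly (p + q) x = rpoly p x + rpoly q x"
  by (simp add: map_poly_of_rat_add)

lemma rpoly_mult: "rpoly (p * q) x = rpoly p x * rpoly q x"
  by (simp add: map_poly_of_rat_mult)

lemma rpoly_smult: "rpoly (smult c p) x = of_rat c * rpoly p x"
  using rpoly_mult[of "[:c:]" p x] by (simp add: map_poly_pCons)

lemma rpoly_diff: "rpoly (p - q) x = rpoly p x - rpoly q x"
  using rpoly_add[of "p - q" q x] by simp

lemma rpoly_power: "rpoly (p ^ n) x = rpoly p x ^ n"
  by (induction n) (simp_all add: rpoly_mult)

lemma rpoly_monom: "rpoly (monom c n) x = of_rat c * x ^ n"
  by (simp add: map_poly_monom poly_monom)

lemma rpoly_sum: "rpoly (\<Sum>i\<in>A. f i) x = (\<Sum>i\<in>A. rpoly (f i) x)"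
  by (induction A rule: infinite_finite_induct) (simp_all add: rpoly_add)

lemma rpoly_pcompose: "rpoly (pcompose p q) x = rpoly p (rpoly q x)"
  by (induction p) (simp_all add: pcompose_pCons rpoly_add rpoly_mult map_poly_pCons)

lemma rpoly_altdef:
  assumes "degree p < n"
  shows "rpoly p x = (\<Sum>i<n. of_rat (coeff p i) * x ^ i)"
proof -
  have "p = (\<Sum>i<n. monom (coeff p i) i)"
    by (rule poly_eqI) (use assms in \<open>auto simp: coeff_sum coeff_eq_0\<close>)
  hence "rpoly p x = rpoly (\<Sum>i<n. monom (coeff p i) i) x" by simp
  thus ?thesis by (simp only: rpoly_sum rpoly_monom)
qed

lemma rpoly_of_real:
  "rpoly p (of_real x :: 'a :: {real_field, field_char_0}) = of_real (rpoly p x)"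
proof -
  have "(of_rat c :: 'a) = of_real (of_rat c)" for c
    by (induction c) (simp add: of_rat_rat)
  thus ?thesis by (induction p) (simp_all add: map_poly_pCons)
qed

lemma rpoly_of_int_poly: "rpoly (map_poly of_int p) x = ipoly p x"
  by (simp add: map_poly_map_poly o_def)

lemma map_poly_of_int_add:
  "map_poly of_int (p + q) = (map_poly of_int p + map_poly of_int q :: rat poly)"
  by (rule poly_eqI) (simp add: coeff_map_poly)

lemma map_poly_of_int_diff:
  "map_poly of_int (p - q) = (map_poly of_int p - map_poly of_int q :: rat poly)"
  by (rule poly_eqI) (simp add: coeff_map_poly)

lemma map_poly_of_int_mult:
  "map_poly of_int (p * q) = (map_poly of_int p * map_poly of_int q :: rat poly)"
  by (rule poly_eqI) (simp add: coeff_map_poly coeff_mult)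

lemma map_poly_of_int_smult:
  "map_poly of_int (smult c p) = (smult (of_int c) (map_poly of_int p) :: rat poly)"
  by (rule poly_eqI) (simp add: coeff_map_poly)

lemma ipoly_add: "ipoly (p + q) x = ipoly p x + ipoly q x"
  unfolding rpoly_of_int_poly[symmetric] by (simp only: map_poly_of_int_add rpoly_add)

lemma ipoly_diff: "ipoly (p - q) x = ipoly p x - ipoly q x"
  unfolding rpoly_of_int_poly[symmetric] by (simp only: map_poly_of_int_diff rpoly_diff)

lemma ipoly_mult: "ipoly (p * q) x = ipoly p x * ipoly q x"
  unfolding rpoly_of_int_poly[symmetric] by (simp only: map_poly_of_int_mult rpoly_mult)

lemma ipoly_smult: "ipoly (smult c p) x = of_int c * ipoly p x"
  using rpoly_smult[of "of_int c" "map_poly of_int p" x]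
  unfolding rpoly_of_int_poly[symmetric] by (simp only: map_poly_of_int_smult) simp

text \<open>Multiplying by every coefficient denominator that occurs makes a single \<open>D\<close>
  serve the whole finite set.\<close>

lemma clear_denominators:
  assumes "finite A"
  obtains D :: int where "D > 0"
    "\<And>p :: rat poly. p \<in> A \<Longrightarrow> \<exists>P. smult (of_int D) p = map_poly of_int P"
proof -
  define C where "C = (\<Union>p\<in>A. set (coeffs p))"
  define D where "D = (\<Prod>c\<in>C. snd (quotient_of c))"
  have C: "finite C" using assms by (simp add: C_def)
  have "D > 0" unfolding D_def by (intro prod_pos) (simp add: quotient_of_denom_pos')
  have int: "of_int D * c \<in> \<int>" if "c \<in> C" for c
  proof -
    have "snd (quotient_of c) dvd D" unfolding D_def using C that by (rule dvd_prodI)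
    then obtain k where k: "D = snd (quotient_of c) * k" by (elim dvdE)
    have "c = of_int (fst (quotient_of c)) / of_int (snd (quotient_of c))"
      by (rule quotient_of_div) simp
    moreover have "snd (quotient_of c) \<noteq> 0"
      using quotient_of_denom_pos'[of c] by linarith
    ultimately have "of_int D * c = of_int (k * fst (quotient_of c))"
      by (simp add: k field_simps)
    thus ?thesis by (metis Ints_of_int)
  qed
  have "\<exists>P. smult (of_int D) p = map_poly of_int P" if "p \<in> A" for p
  proof -
    have "coeff (smult (of_int D) p) i \<in> \<int>" for i
    proof (cases "coeff p i = 0")
      case False
      hence "coeff p i \<in> C" using that coeff_in_coeffs[of p i] le_degree[of p i] by (force simp: C_def)
      thus ?thesis using int by simp
    qed simp
    thus ?thesis by (metis intpolyE)
  qed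
  with \<open>D > 0\<close> show ?thesis by (rule that)
qed

section \<open>Minimal polynomials\<close>

text \<open>Irreducible polynomials over a field are prime, so \<open>m\<close> and \<open>q\<close>
  satisfy a Bezout identity; at a root of \<open>m\<close> it makes the value of \<open>q\<close>
  invertible.\<close>

lemma irreducible_no_common_root:
  fixes m q :: "rat poly"
  assumes "irreducible m" "\<not> m dvd q" "rpoly m x = 0"
  shows "rpoly q x \<noteq> 0"
proof -
  have "coprime m q"
    using assms by (intro prime_elem_imp_coprime field_poly_irreducible_imp_prime)
  then obtain a b where "a * m + b * q = 1"
    using bezout_coefficients_fst_snd[of m q] by auto
  hence "rpoly (a * m + b * q) x = 1" by simp
  hence "rpoly a x * rpoly m x + rpoly b x * rpoly q x = 1" by (simp only: rpoly_add rpoly_mult)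
  thus ?thesis using assms(3) by auto
qed

lemma min_poly_dvd:
  assumes "algebraic x" "rpoly q x = 0"
  shows "min_poly x dvd q"
  using irreducible_no_common_root[of "min_poly x" q x] is_min_poly_min_poly[OF assms(1)] assms(2)
  by (auto simp: is_min_poly_def)

lemma min_poly_degree_pos:
  assumes "algebraic x"
  shows "alg_degree x > 0"
proof (rule ccontr)
  assume "\<not> alg_degree x > 0"
  with is_min_poly_min_poly[OF assms] show False
    by (auto simp: alg_degree_def is_min_poly_def irreducible_def is_unit_iff_degree)
qed

lemma rpoly_root_degree_less:
  assumes "algebraic x" "rpoly q x = 0" "degree q < alg_degree x"
  shows "q = 0"
  using min_poly_dvd[OF assms(1,2)] assms(3) dvd_imp_degree_le[of "min_poly x" q]
  by (force simp: alg_degree_def)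

text \<open>This replaces the embeddings of the field generated by \<open>x\<close>: a rational
  relation for \<open>x\<close> is a multiple of the minimal polynomial, hence passes to each
  conjugate.\<close>

lemma rpoly_conjugate:
  assumes "algebraic x" "rpoly q x = 0" "z \<in> galois_conjugates x"
  shows "rpoly q z = 0"
  using min_poly_dvd[OF assms(1,2)] assms(3)
  by (auto simp: galois_conjugates_def rpoly_mult elim!: dvdE)

lemma self_in_galois_conjugates: "algebraic x \<Longrightarrow> x \<in> galois_conjugates x"
  using is_min_poly_min_poly[of x] by (simp add: galois_conjugates_def is_min_poly_def)

text \<open>Lets the degree of a real base be compared with that of the complex generator.\<close>

lemma min_poly_of_real: "min_poly (complex_of_real x) = min_poly x"
  by (simp add: min_poly_def is_min_poly_def rpoly_of_real)

lemma rpoly_mod: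
  assumes "rpoly m x = 0"
  shows "rpoly (p mod m) x = rpoly p x"
  using rpoly_add[of "p div m * m" "p mod m" x] assms by (simp add: rpoly_mult)

lemma map_poly_of_rat_pderiv:
  "map_poly of_rat (pderiv p) = (pderiv (map_poly of_rat p) :: 'a :: field_char_0 poly)"
  by (rule poly_eqI) (simp add: coeff_map_poly coeff_pderiv of_rat_mult of_rat_add)

text \<open>Separability in characteristic 0: \<open>m\<close> does not divide its derivative, so
  they share no root and \<open>M\<close> splits into distinct linear factors. The count later
  permits interpolation at the conjugates.\<close>

lemma card_galois_conjugates:
  assumes "algebraic (x :: complex)"
  shows "finite (galois_conjugates x)" "card (galois_conjugates x) = alg_degree x"
proof -
  define m where "m = min_poly x"
  define M :: "complex poly" where "M = map_poly of_rat m"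
  have m: "lead_coeff m = 1" "irreducible m" "m \<noteq> 0"
    using is_min_poly_min_poly[OF assms] by (auto simp: m_def is_min_poly_def)
  have deg: "degree M = alg_degree x"
    by (simp add: M_def m_def alg_degree_def degree_map_poly)
  have "\<not> m dvd pderiv m"
    using min_poly_degree_pos[OF assms] not_dvd_pderiv[of m] by (simp add: m_def alg_degree_def)
  hence "rsquarefree M"
    unfolding rsquarefree_roots M_def map_poly_of_rat_pderiv[symmetric]
    using irreducible_no_common_root[OF m(2)] by blast
  hence M: "M = smult (lead_coeff M) (\<Prod>z | poly M z = 0. [:-z, 1:])"
    by (simp add: complex_poly_decompose_rsquarefree)
  have "M \<noteq> 0" using deg min_poly_degree_pos[OF assms] by auto
  have "degree M = (\<Sum>z | poly M z = 0. degree [:-z, 1:])"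
    by (subst M) (use \<open>M \<noteq> 0\<close> in \<open>simp add: degree_prod_eq_sum_degree\<close>)
  hence "degree M = card {z. poly M z = 0}" by simp
  with deg show "card (galois_conjugates x) = alg_degree x"
    by (simp add: galois_conjugates_def M_def m_def)
  show "finite (galois_conjugates x)"
    using poly_roots_finite[OF \<open>M \<noteq> 0\<close>] by (simp add: galois_conjugates_def M_def m_def)
qed

text \<open>A dimension count: the powers of \<open>y\<close> below \<open>d\<close> are independent over the rationals inside the
  \<open>d\<close>-dimensional space spanned by the powers of \<open>x\<close>, so they span it.\<close>

lemma generator_of_equal_degree:
  fixes x y :: "'a :: field_char_0"
  assumes x: "algebraic x" and y: "algebraic y" and deg: "alg_degree y = alg_degree x"
    and B: "y = rpoly B x"
  obtains C where "rpoly C y = x"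
proof -
  interpret V: vector_space "\<lambda>(q :: rat) (v :: 'a). of_rat q * v"
    by unfold_locales (simp_all add: algebra_simps of_rat_add of_rat_mult)
  define d where "d = alg_degree x"
  have d: "d > 0" using min_poly_degree_pos[OF x] by (simp add: d_def)
  define S where "S = (\<lambda>i. y ^ i) ` {..<d}"
  define T where "T = (\<lambda>i. x ^ i) ` {..<d}"
  \<comment> \<open>Such a relation is a polynomial of degree below \<open>d\<close> annihilating
    \<open>y\<close>, and \<open>d\<close> is also the degree of \<open>y\<close>.\<close>
  have zero: "c i = 0" if "(\<Sum>i<d. of_rat (c i) * y ^ i) = 0" "i < d" for c i
  proof -
    define p where "p = (\<Sum>i<d. monom (c i) i)"
    have "degree p < d"
      unfolding p_def using d by (intro degree_sum_less) (auto intro: le_less_trans[OF degree_monom_le])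
    moreover have "rpoly p y = 0" using that by (simp add: p_def rpoly_sum rpoly_monom)
    ultimately have "p = 0" using rpoly_root_degree_less[OF y] deg by (simp add: d_def)
    moreover have "coeff p i = c i" using that by (simp add: p_def coeff_sum)
    ultimately show ?thesis by simp
  qed
  \<comment> \<open>Equal powers would give a relation with coefficients 1 and -1. Injectivity
    ensures that \<open>S\<close> has exactly \<open>d\<close> elements.\<close>
  have inj: "inj_on (\<lambda>i. y ^ i) {..<d}"
  proof (rule inj_onI, rule ccontr)
    fix i j assume ij: "i \<in> {..<d}" "j \<in> {..<d}" "y ^ i = y ^ j" "i \<noteq> j"
    define c :: "nat \<Rightarrow> rat" where "c = (\<lambda>k. (if k = i then 1 else 0) - (if k = j then 1 else 0))"
    have "(\<Sum>k<d. of_rat (c k) * y ^ k) = (\<Sum>k<d. (if k = i then y ^ k else 0) - (if k = j then y ^ k else 0))"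
      by (intro sum.cong) (auto simp: c_def)
    also have "\<dots> = 0" using ij by (simp add: sum_subtractf)
    finally have "c i = 0" using ij zero[of c i] by simp
    thus False using ij by (simp add: c_def)
  qed
  have indep: "V.independent S"
  proof (rule V.independent_if_scalars_zero)
    show "finite S" by (simp add: S_def)
    fix f v assume "(\<Sum>v\<in>S. of_rat (f v) * v) = 0" "v \<in> S"
    thus "f v = 0" using zero[of "\<lambda>i. f (y ^ i)"] by (auto simp: S_def sum.reindex[OF inj] o_def)
  qed
  have span: "rpoly p x \<in> V.span T" for p
  proof -
    have m: "is_min_poly (min_poly x) x" using x by (rule is_min_poly_min_poly)
    have "degree (p mod min_poly x) < d"
      using m d degree_mod_less'[of "min_poly x" p] unfolding d_def alg_degree_def
      by (cases "p mod min_poly x = 0") (force simp: is_min_poly_def)+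
    hence "rpoly (p mod min_poly x) x = (\<Sum>i<d. of_rat (coeff (p mod min_poly x) i) * x ^ i)"
      by (rule rpoly_altdef)
    also have "\<dots> \<in> V.span T"
      by (intro V.span_sum V.span_scale V.span_base) (simp add: T_def)
    finally show ?thesis using m rpoly_mod[of "min_poly x" x p] by (simp add: is_min_poly_def)
  qed
  \<comment> \<open>Otherwise \<open>insert x S\<close> would consist of \<open>d + 1\<close>
    independent vectors in the span of the at most \<open>d\<close> elements of
    \<open>T\<close>.\<close>
  have "x \<in> V.span S"
  proof (rule ccontr)
    assume nin: "x \<notin> V.span S"
    have "rpoly [:0, 1:] x \<in> V.span T" by (rule span)
    moreover have "y ^ i \<in> V.span T" for i
      using span[of "B ^ i"] by (simp add: rpoly_power B)
    ultimately have sub: "insert x S \<subseteq> V.span T" by (auto simp: S_def map_poly_pCons)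
    have "finite T" by (simp add: T_def)
    from V.independent_span_bound[OF this V.independent_insertI[OF nin indep] sub]
    have "card (insert x S) \<le> card T" by simp
    also have "card T \<le> d" unfolding T_def by (rule order.trans[OF card_image_le]) auto
    finally have "card (insert x S) \<le> d" .
    moreover have "x \<notin> S" using nin V.span_base[of x S] by blast
    moreover have "card S = d" "finite S" using inj by (simp_all add: S_def card_image)
    ultimately show False by simp
  qed
  then obtain u where "x = (\<Sum>v\<in>S. of_rat (u v) * v)"
    using V.span_finite[of S] by (auto simp: S_def)
  hence "x = rpoly (\<Sum>i<d. monom (u (y ^ i)) i) y"
    by (simp add: S_def sum.reindex[OF inj] rpoly_sum rpoly_monom)
  thus ?thesis using that by metis
qed

section \<open>Algebraic integers with bounded conjugates\<close>

text \<open>\<open>L\<close> depends on \<open>A\<close> alone, so the coefficients of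
  \<open>p\<close> are fixed linear functions of its values on \<open>A\<close>.\<close>

lemma lagrange_interpolation:
  fixes A :: "complex set"
  assumes "finite A"
  obtains L :: "complex \<Rightarrow> complex poly"
  where "\<And>p. degree p < card A \<Longrightarrow> p = (\<Sum>z\<in>A. smult (poly p z) (L z))"
proof -
  define L where "L = (\<lambda>z. \<Prod>w\<in>A - {z}. smult (1 / (z - w)) [:-w, 1:])"
  have L: "poly (L z) y = (if y = z then 1 else 0)" if "z \<in> A" "y \<in> A" for y z
  proof (cases "y = z")
    case True
    have "poly (smult (1 / (z - w)) [:-w, 1:]) z = 1" if "w \<in> A - {z}" for w
      using that by (auto simp: divide_simps)
    thus ?thesis using True unfolding L_def poly_prod by (simp add: prod.neutral)
  next
    case False
    thus ?thesis using that assms by (auto simp: L_def poly_prod)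
  qed
  have degL: "degree (L z) < card A" if "z \<in> A" for z
  proof -
    have "degree (L z) \<le> (\<Sum>w\<in>A - {z}. degree (smult (1 / (z - w)) [:-w, 1:]))"
      unfolding L_def using degree_prod_sum_le[of "A - {z}" "\<lambda>w. smult (1 / (z - w)) [:-w, 1:]"] assms
      by (simp only: o_def finite_Diff)
    also have "\<dots> \<le> (\<Sum>w\<in>A - {z}. 1)" by (intro sum_mono) auto
    also have "\<dots> < card A" using card_Diff1_less[OF assms that] by simp
    finally show ?thesis .
  qed
  have "p = (\<Sum>z\<in>A. smult (poly p z) (L z))" if "degree p < card A" for p
  proof (rule poly_eqI_degree[of A])
    show "card A > degree (\<Sum>z\<in>A. smult (poly p z) (L z))"
      using that degL by (intro degree_sum_less) (auto intro: le_less_trans[OF degree_smult_le])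
    fix y assume "y \<in> A"
    hence "poly (\<Sum>z\<in>A. smult (poly p z) (L z)) y = (\<Sum>z\<in>A. if y = z then poly p z else 0)"
      unfolding poly_sum by (intro sum.cong) (auto simp: L)
    also have "\<dots> = poly p y" using \<open>y \<in> A\<close> assms by simp
    finally show "poly p y = poly (\<Sum>z\<in>A. smult (poly p z) (L z)) y" by simp
  qed (fact that)
  thus ?thesis by (rule that)
qed

text \<open>By interpolation, bounded values force bounded coefficients, and integer lists of
  bounded length and entries are finite in number.\<close>

lemma finite_int_polys_bounded_values:
  fixes A :: "complex set"
  assumes "finite A"
  shows "finite {P :: int poly. degree P < card A \<and> (\<forall>z\<in>A. cmod (ipoly P z) \<le> C)}"
    (is "finite ?S")
proof -
  obtain L where L: "\<And>p. degree p < card A \<Longrightarrow> p = (\<Sum>z\<in>A. smult (poly p z) (L z))"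
    using lagrange_interpolation[OF assms] by blast
  \<comment> \<open>Summing over all \<open>i\<close> gives one bound for every coefficient; the
    absolute value of \<open>C\<close> keeps the summands nonnegative.\<close>
  define K where "K = \<lceil>\<Sum>i<card A. \<Sum>z\<in>A. \<bar>C\<bar> * cmod (coeff (L z) i)\<rceil>"
  have bound: "coeff P i \<in> {-K..K}" if P: "P \<in> ?S" and i: "i < card A" for P i
  proof -
    let ?p = "map_poly of_int P :: complex poly"
    have "?p = (\<Sum>z\<in>A. smult (poly ?p z) (L z))" using P by (intro L) (simp add: degree_map_poly)
    hence "coeff ?p i = (\<Sum>z\<in>A. poly ?p z * coeff (L z) i)"
      by (metis (no_types, lifting) coeff_smult coeff_sum sum.cong)
    hence "cmod (of_int (coeff P i)) = cmod (\<Sum>z\<in>A. poly ?p z * coeff (L z) i)"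
      by (simp add: coeff_map_poly)
    also have "\<dots> \<le> (\<Sum>z\<in>A. cmod (poly ?p z * coeff (L z) i))" by (rule norm_sum)
    also have "\<dots> \<le> (\<Sum>z\<in>A. \<bar>C\<bar> * cmod (coeff (L z) i))"
    proof (rule sum_mono)
      fix z assume "z \<in> A"
      hence "cmod (poly ?p z) \<le> \<bar>C\<bar>" using P by force
      thus "cmod (poly ?p z * coeff (L z) i) \<le> \<bar>C\<bar> * cmod (coeff (L z) i)"
        by (simp add: norm_mult mult_right_mono)
    qed
    also have "\<dots> \<le> (\<Sum>i<card A. \<Sum>z\<in>A. \<bar>C\<bar> * cmod (coeff (L z) i))"
      using i by (intro member_le_sum) (auto intro: sum_nonneg)
    also have "\<dots> \<le> of_int K" unfolding K_def by linarith
    finally have "\<bar>of_int (coeff P i)\<bar> \<le> (of_int K :: real)" by simp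
    hence "\<bar>coeff P i\<bar> \<le> K" by linarith
    thus ?thesis by auto
  qed
  have "?S \<subseteq> Poly ` {xs. set xs \<subseteq> {-K..K} \<and> length xs \<le> card A}"
  proof
    fix P assume P: "P \<in> ?S"
    have "set (coeffs P) \<subseteq> {-K..K}"
    proof
      fix c assume "c \<in> set (coeffs P)"
      then obtain i where "i \<le> degree P" "c = coeff P i" 
        by (cases "P = 0") (auto simp: coeffs_def less_Suc_eq_le simp del: upt_Suc)
      thus "c \<in> {-K..K}" using bound[OF P, of i] P by auto
    qed
    moreover have "length (coeffs P) \<le> card A" using P by (cases "P = 0", auto simp: length_coeffs)
    ultimately show "P \<in> Poly ` {xs. set xs \<subseteq> {-K..K} \<and> length xs \<le> card A}"
      by (intro image_eqI[of _ _ "coeffs P"]) auto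
  qed
  thus ?thesis by (rule finite_subset) (simp add: finite_lists_length_le)
qed

text \<open>The minimal polynomial need not be known to be integral: a monic integer annihilator \<open>f\<close> bounds the
  degree, and then a single denominator \<open>D\<close> suffices for the reductions modulo the minimal polynomial.\<close>

lemma finite_bounded_conjugates:
  fixes x :: complex
  assumes "algebraic_int x"
  shows "finite {ipoly P x | P. \<forall>z\<in>galois_conjugates x. cmod (ipoly P z) \<le> C}" (is "finite ?S")
proof -
  have alg: "algebraic x" using assms by auto
  define m where "m = min_poly x"
  have m: "lead_coeff m = 1" "rpoly m x = 0" "m \<noteq> 0"
    using is_min_poly_min_poly[OF alg] by (auto simp: m_def is_min_poly_def)
  define d where "d = alg_degree x"
  have d: "d > 0" "degree m = d"
    using min_poly_degree_pos[OF alg] by (simp_all add: d_def m_def alg_degree_def)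
  have degmod: "degree (p mod m) < d" for p
    using d m degree_mod_less'[of m p] by (cases "p mod m = 0") auto
  obtain f where f: "ipoly f x = 0" "lead_coeff f = 1"
    using assms unfolding algebraic_int_altdef_ipoly by auto
  define n where "n = degree f"
  have n: "n > 0"
  proof (rule ccontr)
    assume "\<not> n > 0"
    hence "f = 1" using f(2) by (auto simp: n_def elim!: degree_eq_zeroE)
    thus False using f(1) by simp
  qed
  obtain D :: int where D: "D > 0"
    "\<And>p :: rat poly. p \<in> (\<lambda>j. monom 1 j mod m) ` {..<n} \<Longrightarrow> \<exists>P. smult (of_int D) p = map_poly of_int P"
    using clear_denominators[of "(\<lambda>j. monom 1 j mod m) ` {..<n}"] by auto
  \<comment> \<open>\<open>R j\<close> is an integral representative of \<open>D\<close> times the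
    \<open>j\<close>-th power: degree below \<open>d\<close>, same values at all conjugates.\<close>
  define R where "R = (\<lambda>j. SOME P. smult (of_int D) (monom 1 j mod m) = map_poly of_int P)"
  have R: "smult (of_int D) (monom 1 j mod m) = map_poly of_int (R j)" if "j < n" for j
    unfolding R_def by (rule someI_ex) (use D(2) that in auto)
  have degR: "degree (R j) < d" if "j < n" for j
    using arg_cong[OF R[OF that], of degree] degmod[of "monom 1 j"] D(1)
    by (simp add: degree_map_poly)
  have root: "rpoly m z = 0" if "z \<in> galois_conjugates x" for z
    using that by (simp add: galois_conjugates_def m_def)
  have evR: "ipoly (R j) z = of_int D * z ^ j" if "j < n" "z \<in> galois_conjugates x" for j z
  proof -
    have "ipoly (R j) z = rpoly (smult (of_int D) (monom 1 j mod m)) z"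
      by (simp only: R[OF that(1)] rpoly_of_int_poly)
    thus ?thesis by (simp add: rpoly_smult rpoly_mod[OF root[OF that(2)]] rpoly_monom)
  qed
  define F where "F = {P :: int poly. degree P < card (galois_conjugates x) \<and>
    (\<forall>z\<in>galois_conjugates x. cmod (ipoly P z) \<le> of_int D * C)}"
  have "finite F" unfolding F_def
    by (rule finite_int_polys_bounded_values) (rule card_galois_conjugates[OF alg])
  have "?S \<subseteq> (\<lambda>P. ipoly P x / of_int D) ` F"
  proof
    fix v assume "v \<in> ?S"
    then obtain P where P: "v = ipoly P x" "\<forall>z\<in>galois_conjugates x. cmod (ipoly P z) \<le> C" by auto
    \<comment> \<open>As \<open>f\<close> is monic, this is true division over the integers;
      \<open>f\<close> vanishes at all conjugates, so \<open>Q\<close> has the values of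
      \<open>P\<close> there.\<close>
    obtain q Q where qQ: "pseudo_divmod P f = (q, Q)" by force
    have "f \<noteq> 0" using f(2) by auto
    from pseudo_divmod[OF this qQ] f(2) n have Q: "P = f * q + Q" "degree Q < n"
      by (auto simp: n_def)
    have fz: "ipoly f z = 0" if "z \<in> galois_conjugates x" for z
      using rpoly_conjugate[OF alg _ that, of "map_poly of_int f"] f(1)
      by (simp only: rpoly_of_int_poly)
    \<comment> \<open>Putting \<open>R j\<close> for the \<open>j\<close>-th power in
      \<open>Q\<close> scales the values at the conjugates by \<open>D\<close>, which explains the
      bound in \<open>F\<close>.\<close>
    define P' where "P' = (\<Sum>j<n. smult (coeff Q j) (R j))"
    have ev: "ipoly P' z = of_int D * ipoly P z" if z: "z \<in> galois_conjugates x" for z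
    proof -
      have "ipoly P' z = (\<Sum>j<n. of_int (coeff Q j) * ipoly (R j) z)"
        unfolding P'_def
      proof (induction n)
        case (Suc n)
        thus ?case by (simp add: ipoly_add ipoly_smult)
      qed simp
      also have "\<dots> = of_int D * (\<Sum>j<n. of_int (coeff Q j) * z ^ j)"
        unfolding sum_distrib_left by (intro sum.cong) (use z in \<open>auto simp: evR\<close>)
      also have "(\<Sum>j<n. of_int (coeff Q j) * z ^ j) = ipoly Q z"
        using rpoly_altdef[of "map_poly of_int Q" n z] Q(2)
        by (simp add: rpoly_of_int_poly coeff_map_poly degree_map_poly)
      also have "\<dots> = ipoly P z" using fz[OF z] by (simp add: Q(1) ipoly_add ipoly_mult)
      finally show ?thesis .
    qed
    have "degree P' < d"
      unfolding P'_def using d degR by (intro degree_sum_less) (auto intro: le_less_trans[OF degree_smult_le])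
    moreover have "cmod (ipoly P' z) \<le> of_int D * C" if "z \<in> galois_conjugates x" for z
      using P(2) D(1) that by (simp add: ev norm_mult)
    ultimately have "P' \<in> F" by (simp add: F_def card_galois_conjugates[OF alg] d_def)
    moreover have "v = ipoly P' x / of_int D"
      using ev[OF self_in_galois_conjugates[OF alg]] D(1) by (simp add: P(1))
    ultimately show "v \<in> (\<lambda>P. ipoly P x / of_int D) ` F" by blast
  qed
  thus ?thesis by (rule finite_subset) (simp add: \<open>finite F\<close>)
qed

section \<open>Orbits under Pisot bases\<close>

text \<open>The minimal polynomial of \<beta> composed with \<open>B\<close> vanishes at \<delta>,
  hence at \<open>z\<close>, so \<open>B\<close> sends \<open>z\<close> to a conjugate of
  \<beta>.\<close>

lemma Pisot_conjugate_less_1: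
  assumes \<delta>: "algebraic \<delta>" and \<beta>: "Pisot \<beta>" "alg_degree \<beta> = alg_degree \<delta>"
    and B: "complex_of_real \<beta> = ipoly B \<delta>" and z: "z \<in> galois_conjugates \<delta>" "z \<noteq> \<delta>"
  shows "cmod (ipoly B z) < 1"
proof -
  let ?B = "map_poly of_int B :: rat poly" and ?\<beta> = "complex_of_real \<beta>"
  have alg: "algebraic ?\<beta>" using \<beta>(1) by (auto simp: Pisot_def)
  have B': "?\<beta> = rpoly ?B \<delta>" by (simp only: B rpoly_of_int_poly)
  have "alg_degree ?\<beta> = alg_degree \<delta>" using \<beta>(2) by (simp add: alg_degree_def min_poly_of_real)
  then obtain C where C: "rpoly C ?\<beta> = \<delta>"
    using generator_of_equal_degree[OF \<delta> alg _ B'] by blast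
  have "rpoly (pcompose (min_poly \<beta>) ?B) \<delta> = 0"
    using is_min_poly_min_poly[OF alg] by (simp add: rpoly_pcompose B'[symmetric] is_min_poly_def min_poly_of_real)
  hence "rpoly (pcompose (min_poly \<beta>) ?B) z = 0" using \<delta> z(1) by (intro rpoly_conjugate)
  hence "rpoly ?B z \<in> galois_conjugates \<beta>" by (simp add: rpoly_pcompose galois_conjugates_def)
  \<comment> \<open>The relation that \<open>C\<close> inverts \<open>B\<close> at \<delta> passes
    to \<open>z\<close>; equal images under \<open>B\<close> would then force
    \<open>z = \<delta>\<close>.\<close>
  moreover have "rpoly ?B z \<noteq> ?\<beta>"
  proof
    assume eq: "rpoly ?B z = ?\<beta>"
    have "rpoly (pcompose C ?B - [:0, 1:]) \<delta> = 0"
      using C by (simp add: rpoly_diff rpoly_pcompose B'[symmetric] map_poly_pCons)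
    hence "rpoly (pcompose C ?B - [:0, 1:]) z = 0" using \<delta> z(1) by (intro rpoly_conjugate)
    hence "z = \<delta>" using C eq by (simp add: rpoly_diff rpoly_pcompose map_poly_pCons)
    thus False using z(2) by simp
  qed
  ultimately show ?thesis using \<beta>(1) by (simp add: Pisot_def rpoly_of_int_poly)
qed

text \<open>Any \<open>M\<close> beyond the fixed point of the affine map with slope \<rho> works;
  the maximum also covers the starting value \<open>a\<close>.\<close>

lemma contraction_bound:
  fixes \<rho> a c :: real
  assumes "\<rho> < 1"
  obtains M where "a \<le> M" "M \<ge> 0" "\<rho> * M + c \<le> M"
proof
  let ?M = "max \<bar>a\<bar> (\<bar>c\<bar> / (1 - \<rho>))"
  show "a \<le> ?M" "?M \<ge> 0" by auto
  have "\<bar>c\<bar> / (1 - \<rho>) \<le> ?M" by simp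
  hence "\<bar>c\<bar> \<le> ?M * (1 - \<rho>)" using assms by (subst (asm) pos_divide_le_eq) auto
  hence "\<rho> * ?M + \<bar>c\<bar> \<le> ?M" by (simp add: algebra_simps)
  thus "\<rho> * ?M + c \<le> ?M" by linarith
qed

text \<open>Both transducers are instances of \<open>R\<close>: all that matters is that a step
  stays in the unit interval and subtracts some integer from \<beta>\<open>* s\<close>.\<close>

lemma finite_Pisot_orbit:
  fixes \<delta> :: complex and E :: "real set" and R :: "(real \<times> real) set"
  assumes \<delta>: "algebraic_int \<delta>" and "finite E"
    and E: "\<And>\<beta>. \<beta> \<in> E \<Longrightarrow> Pisot \<beta> \<and> alg_degree \<beta> = alg_degree \<delta> \<and> complex_of_real \<beta> \<in> int_adjoin \<delta>"
    and r: "r \<in> {0..1}" "complex_of_real r \<in> rat_adjoin \<delta>"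
    and step: "\<And>s t. (s, t) \<in> R \<Longrightarrow> s \<in> {0..1} \<Longrightarrow>
      t \<in> {0..1} \<and> (\<exists>\<beta>\<in>E. \<exists>k :: int. t = \<beta> * s - of_int k)"
  shows "finite {s. (r, s) \<in> R\<^sup>*}"
proof -
  have alg: "algebraic \<delta>" using \<delta> by auto
  have "\<forall>\<beta>\<in>E. \<exists>B. complex_of_real \<beta> = ipoly B \<delta>" using E by (fastforce simp: int_adjoin_def)
  then obtain B where B: "\<And>\<beta>. \<beta> \<in> E \<Longrightarrow> complex_of_real \<beta> = ipoly (B \<beta>) \<delta>" by metis
  obtain P0 q where Pq: "ipoly q \<delta> \<noteq> 0" "ipoly q \<delta> * of_real r = ipoly P0 \<delta>"
  proof -
    obtain p' q' where pq: "complex_of_real r = rpoly p' \<delta> / rpoly q' \<delta>" "rpoly q' \<delta> \<noteq> 0"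
      using r(2) by (auto simp: rat_adjoin_def)
    obtain D :: int where D: "D > 0"
      "\<And>p :: rat poly. p \<in> {p', q'} \<Longrightarrow> \<exists>P. smult (of_int D) p = map_poly of_int P"
      using clear_denominators[of "{p', q'}"] by auto
    from D(2) obtain P Q where PQ: "smult (of_int D) p' = map_poly of_int P"
      "smult (of_int D) q' = map_poly of_int Q" by blast
    have "ipoly P \<delta> = of_int D * rpoly p' \<delta>" "ipoly Q \<delta> = of_int D * rpoly q' \<delta>"
      unfolding rpoly_of_int_poly[symmetric] PQ[symmetric] by (simp_all add: rpoly_smult)
    thus ?thesis using pq D(1) by (intro that[of Q P]) auto
  qed
  \<comment> \<open>Bounds every digit: \<open>k = \<beta> * s - t\<close> lies between -1 and
    \<beta>, and the sum dominates each base because all are positive.\<close>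
  define K where "K = (\<Sum>\<beta>\<in>E. \<beta>) + 1"
  have K: "\<beta> + 1 \<le> K" if "\<beta> \<in> E" for \<beta>
    unfolding K_def using that E \<open>finite E\<close> member_le_sum[of \<beta> E "\<lambda>x. x"]
    by (force simp: Pisot_def)
  have "\<exists>M. cmod (ipoly P0 z) \<le> M \<and> M \<ge> 0 \<and>
      (\<forall>\<beta>\<in>E. cmod (ipoly (B \<beta>) z) * M + K * cmod (ipoly q z) \<le> M)"
    if z: "z \<in> galois_conjugates \<delta>" "z \<noteq> \<delta>" for z
  proof -
    \<comment> \<open>One contraction rate for all bases, since they may be read in any order; the
      inserted 0 covers an empty \<open>E\<close>.\<close>
    define \<rho> where "\<rho> = Max (insert 0 ((\<lambda>\<beta>. cmod (ipoly (B \<beta>) z)) ` E))"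
    have "\<rho> < 1"
      unfolding \<rho>_def using \<open>finite E\<close> E B Pisot_conjugate_less_1[OF alg _ _ _ z] by auto
    then obtain M where M: "cmod (ipoly P0 z) \<le> M" "M \<ge> 0" "\<rho> * M + K * cmod (ipoly q z) \<le> M"
      by (rule contraction_bound)
    have "cmod (ipoly (B \<beta>) z) * M + K * cmod (ipoly q z) \<le> M" if "\<beta> \<in> E" for \<beta>
    proof -
      have "cmod (ipoly (B \<beta>) z) \<le> \<rho>" unfolding \<rho>_def using \<open>finite E\<close> that by auto
      from mult_right_mono[OF this M(2)] show ?thesis using M(3) by linarith
    qed
    with M show ?thesis by blast
  qed
  then obtain M where M: "\<And>z. z \<in> galois_conjugates \<delta> \<Longrightarrow> z \<noteq> \<delta> \<Longrightarrow> cmod (ipoly P0 z) \<le> M z \<and> M z \<ge> 0 \<and>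
      (\<forall>\<beta>\<in>E. cmod (ipoly (B \<beta>) z) * M z + K * cmod (ipoly q z) \<le> M z)"
    by metis
  \<comment> \<open>\<open>P\<close> may depend on the path to \<open>s\<close>. The point \<delta>
    is excluded because \<open>B\<close> \<beta> takes the expanding value \<beta> there; membership
    of \<open>s\<close> in the unit interval controls that value instead.\<close>
  have inv: "s \<in> {0..1} \<and> (\<exists>P. ipoly q \<delta> * of_real s = ipoly P \<delta> \<and>
      (\<forall>z\<in>galois_conjugates \<delta> - {\<delta>}. cmod (ipoly P z) \<le> M z))" if "(r, s) \<in> R\<^sup>*" for s
    using that
  proof (induction rule: rtrancl_induct)
    case base
    thus ?case using r(1) Pq M by blast
  next
    case (step s t)
    then obtain P where s: "s \<in> {0..1}" and P: "ipoly q \<delta> * of_real s = ipoly P \<delta>"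
      "\<And>z. z \<in> galois_conjugates \<delta> \<Longrightarrow> z \<noteq> \<delta> \<Longrightarrow> cmod (ipoly P z) \<le> M z" by blast
    from assms(6)[OF step.hyps(2) s] obtain \<beta> and k :: int
      where t: "t \<in> {0..1}" "t = \<beta> * s - of_int k" and \<beta>: "\<beta> \<in> E" by blast
    have "\<beta> > 1" using E[OF \<beta>] by (simp add: Pisot_def)
    hence "0 \<le> \<beta> * s" "\<beta> * s \<le> \<beta>" using s by (auto simp: mult_left_le)
    hence k: "\<bar>of_int k\<bar> \<le> K" using t K[OF \<beta>] by auto
    define P' where "P' = B \<beta> * P - smult k q"
    have "ipoly q \<delta> * of_real t = ipoly P' \<delta>"
      by (simp add: P'_def ipoly_diff ipoly_mult ipoly_smult t(2) B[OF \<beta>, symmetric] P(1)[symmetric] algebra_simps)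
    moreover have "cmod (ipoly P' z) \<le> M z" if z: "z \<in> galois_conjugates \<delta>" "z \<noteq> \<delta>" for z
    proof -
      have "cmod (ipoly P' z) \<le> cmod (ipoly (B \<beta>) z * ipoly P z) + cmod (of_int k * ipoly q z)"
        unfolding P'_def ipoly_diff ipoly_mult ipoly_smult by (rule norm_triangle_ineq4)
      also have "\<dots> \<le> cmod (ipoly (B \<beta>) z) * M z + K * cmod (ipoly q z)"
        unfolding norm_mult using P(2)[OF z] k by (intro add_mono mult_left_mono mult_right_mono) auto
      also have "\<dots> \<le> M z" using M[OF z] \<beta> by blast
      finally show ?thesis .
    qed
    ultimately show ?case using t(1) by blast
  qed
  \<comment> \<open>The entry for \<delta> itself is the bound by \<open>q\<close>; the unspecified
    \<open>M\<close> \<delta> can only enlarge the maximum.\<close>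
  define C where "C = Max (insert (cmod (ipoly q \<delta>)) (M ` galois_conjugates \<delta>))"
  have fin: "finite (galois_conjugates \<delta>)" by (rule card_galois_conjugates[OF alg])
  define V where "V = {ipoly P \<delta> | P. \<forall>z\<in>galois_conjugates \<delta>. cmod (ipoly P z) \<le> C}"
  have "{s. (r, s) \<in> R\<^sup>*} \<subseteq> (\<lambda>v. Re (v / ipoly q \<delta>)) ` V"
  proof
    fix s assume "s \<in> {s. (r, s) \<in> R\<^sup>*}"
    with inv obtain P where s: "s \<in> {0..1}" and P: "ipoly q \<delta> * of_real s = ipoly P \<delta>"
      "\<And>z. z \<in> galois_conjugates \<delta> \<Longrightarrow> z \<noteq> \<delta> \<Longrightarrow> cmod (ipoly P z) \<le> M z" by blast
    have "cmod (ipoly P z) \<le> C" if z: "z \<in> galois_conjugates \<delta>" for z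
    proof (cases "z = \<delta>")
      case True
      have "cmod (ipoly P \<delta>) \<le> cmod (ipoly q \<delta>)"
        using s by (simp add: P(1)[symmetric] norm_mult mult_left_le)
      also have "\<dots> \<le> C" unfolding C_def using fin by simp
      finally show ?thesis using True by simp
    next
      case False
      have "M z \<le> C" unfolding C_def using fin z by simp
      with P(2)[OF z False] show ?thesis by linarith
    qed
    hence "ipoly P \<delta> \<in> V" by (auto simp: V_def)
    moreover have "s = Re (ipoly P \<delta> / ipoly q \<delta>)" using Pq(1) by (simp add: P(1)[symmetric])
    ultimately show "s \<in> (\<lambda>v. Re (v / ipoly q \<delta>)) ` V" by blast
  qed
  moreover have "finite V" unfolding V_def by (rule finite_bounded_conjugates[OF \<delta>])
  ultimately show ?thesis by (rule finite_subset[OF _ finite_imageI])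
qed

section \<open>Application to the greedy and quasi-greedy transducers\<close>

theorem theorem3p9:
  fixes \<delta> :: complex and d :: nat and E :: "real set"
  assumes "algebraic_int \<delta>" and "alg_degree \<delta> = d"
    and "finite E"
    and "\<And>\<beta>. \<beta> \<in> E \<Longrightarrow> Pisot \<beta> \<and> alg_degree \<beta> = d \<and> complex_of_real \<beta> \<in> int_adjoin \<delta>"
  shows "\<forall>r\<in>{0..1}. complex_of_real r \<in> rat_adjoin \<delta> \<longrightarrow>
           finite (states (reachable_part (greedy_transducer E) r)) \<and>
           finite (states (reachable_part (quasi_greedy_transducer E) r))"
proof (intro ballI impI conjI)
  fix r :: real assume r: "r \<in> {0..1}" "complex_of_real r \<in> rat_adjoin \<delta>"
  have E: "\<And>\<beta>. \<beta> \<in> E \<Longrightarrow> Pisot \<beta> \<and> alg_degree \<beta> = alg_degree \<delta> \<and> complex_of_real \<beta> \<in> int_adjoin \<delta>"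
    using assms by simp
  note orbit = finite_Pisot_orbit[OF assms(1,3) E r]
  have "finite {s. (r, s) \<in> (steps (greedy_transducer E))\<^sup>*}"
  proof (rule orbit)
    fix s t assume "(s, t) \<in> steps (greedy_transducer E)"
    then obtain \<beta> where "\<beta> \<in> E" "t = T_greedy \<beta> s"
      by (auto simp: steps_def greedy_transducer_def)
    thus "t \<in> {0..1} \<and> (\<exists>\<beta>\<in>E. \<exists>k :: int. t = \<beta> * s - of_int k)"
      using T_greedy_range[of \<beta> s] by (fastforce simp: T_greedy_def)
  qed
  thus "finite (states (reachable_part (greedy_transducer E) r))"
    by (rule rev_finite_subset) (auto simp: reachable_part_def)
  have "finite {s. (r, s) \<in> (steps (quasi_greedy_transducer E))\<^sup>*}"
  proof (rule orbit)
    fix s t assume "(s, t) \<in> steps (quasi_greedy_transducer E)"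
    then obtain \<beta> where \<beta>: "\<beta> \<in> E" "t = T_quasi \<beta> s"
      by (auto simp: steps_def quasi_greedy_transducer_def)
    \<comment> \<open>At state 0 the subtracted integer must be 0: the ceiling formula would give -1
      and lead to 1 instead of 0.\<close>
    have "t = \<beta> * s - of_int (if s = 0 then 0 else \<lceil>\<beta> * s - 1\<rceil>)"
      by (simp add: \<beta> T_quasi_def)
    thus "t \<in> {0..1} \<and> (\<exists>\<beta>\<in>E. \<exists>k :: int. t = \<beta> * s - of_int k)"
      using T_quasi_range[of \<beta> s] \<beta> by metis
  qed
  thus "finite (states (reachable_part (quasi_greedy_transducer E) r))"
    by (rule rev_finite_subset) (auto simp: reachable_part_def)
qed

end
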